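(* Let $n \ge 2$ and $r > n-1$, and suppose that $\widetilde{\mathbf b}\in\mathbb R^n$ satisfies the Diophantine condition: there is $c>0$ with $|\widetilde{\mathbf b}\cdot \mathbf j|\ge c\,|\mathbf j|^{-r}$ for all $\mathbf j\in\mathbb Z^n\setminus\{\mathbf 0\}$. Let $m\ge 1$ be an integer and let $(\mathbf V_0,\mathbf H_0)\in H^m(\mathbb T^n)$ satisfy the mean-free conditions $$\int_{\mathbb T^n}\mathbf V_0\,d\mathbf x=\mathbf 0,\qquad \int_{\mathbb T^n}\mathbf H_0\,d\mathbf x=\mathbf 0 .$$ Then the corresponding solution $(\mathbf V,\mathbf H)$ of the linear system $$\begin{cases}\partial_t\mathbf V+\mathbf V=\widetilde{\mathbf b}\cdot\nabla\mathbf H,\\ \partial_t\mathbf H=\widetilde{\mathbf b}\cdot\nabla\mathbf V,\\ \nabla\cdot\mathbf V=\nabla\cdot\mathbf H=0,\\ \mathbf V(\mathbf x,0)=\mathbf V_0(\mathbf x),\quad \mathbf H(\mathbf x,0)=\mathbf H_0(\mathbf x),\end{cases}$$ satisfies, for all $t\ge 0$ and with a constant $C>0$ independent of $t$, $$\|\mathbf V(t)\|_{H^s(\mathbb T^n)}\le\begin{cases}C(1+t)^{-\frac12-\frac{m-s}{2r}}\,\|(\mathbf V_0,\mathbf H_0)\|_{H^m(\mathbb T^n)}, & 0\le s\le m-1,\\ C\,\|(\mathbf V_0,\mathbf H_0)\|_{H^m(\mathbb T^n)}, & s=m,\end{cases}$$ $$\|\mathbf H(t)\|_{H^s(\mathbb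 T^n)}\le C(1+t)^{-\frac{m-s}{2r}}\,\|(\mathbf V_0,\mathbf H_0)\|_{H^m(\mathbb T^n)},\qquad 0\le s\le m .$$
   Context: $\mathbb T^n=[0,2\pi]^n$ is the periodic torus. $\mathbf V,\mathbf H:\mathbb T^n\times[0,\infty)\to\mathbb R^n$ are vector fields; the system includes the divergence-free constraints, so the initial data $\mathbf V_0,\mathbf H_0$ are divergence free. $\widetilde{\mathbf b}\in\mathbb R^n$ is a fixed constant vector. *)

theory Defs
  imports "HOL-Analysis.Analysis"
begin

text \<open>
  Functions on the torus are functions on \<open>real^'n\<close> of which only the restriction to the box
  \<open>[0, 2\<pi>]^n\<close> matters (up to null sets); they need not be periodic. Periodicity enters
  through the test functions and the Fourier characters.
\<close>

abbreviation torus :: "(real^'n) measure" where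
  "torus \<equiv> lebesgue_on (cbox 0 (\<chi> i. 2 * pi))"

definition ivec :: "int^'n \<Rightarrow> real^'n" where
  "ivec k = (\<chi> i. real_of_int (k $ i))"

definition diophantine :: "real \<Rightarrow> real^'n \<Rightarrow> bool" where
  "diophantine r b \<longleftrightarrow>
     (\<exists>c>0. \<forall>j::int^'n. j \<noteq> 0 \<longrightarrow> \<bar>b \<bullet> ivec j\<bar> \<ge> c * norm (ivec j) powr (- r))"

definition L2_torus :: "(real^'n \<Rightarrow> real^'n) set" where
  "L2_torus = {f \<in> borel_measurable torus. integrable torus (\<lambda>x. (norm (f x))\<^sup>2)}"

definition fourier_coeff :: "(real^'n \<Rightarrow> real^'n) \<Rightarrow> int^'n \<Rightarrow> complex^'n" where
  "fourier_coeff f k =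
     (\<chi> i. (LINT x|torus. cis (- (ivec k \<bullet> x)) * complex_of_real (f x $ i)) / (2 * pi) ^ CARD('n))"

definition sobolev_term :: "real \<Rightarrow> (real^'n \<Rightarrow> real^'n) \<Rightarrow> int^'n \<Rightarrow> real" where
  "sobolev_term s f k = (1 + (norm (ivec k))\<^sup>2) powr s * (norm (fourier_coeff f k))\<^sup>2"

text \<open>The space \<open>H\<^sup>s\<close> of vector fields on the torus, for real \<open>s \<ge> 0\<close>, and its norm.
  The norm is only meaningful on members of the space.\<close>

definition sobolev :: "real \<Rightarrow> (real^'n \<Rightarrow> real^'n) set" where
  "sobolev s = {f \<in> L2_torus. sobolev_term s f summable_on UNIV}"

definition sobolev_norm :: "real \<Rightarrow> (real^'n \<Rightarrow> real^'n) \<Rightarrow> real" where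
  "sobolev_norm s f = sqrt (\<Sum>\<^sub>\<infinity>k. sobolev_term s f k)"

definition sobolev_norm2 :: "real \<Rightarrow> (real^'n \<Rightarrow> real^'n) \<Rightarrow> (real^'n \<Rightarrow> real^'n) \<Rightarrow> real" where
  "sobolev_norm2 s f g = sqrt ((sobolev_norm s f)\<^sup>2 + (sobolev_norm s g)\<^sup>2)"

abbreviation partial :: "'n \<Rightarrow> (real^'n \<Rightarrow> real) \<Rightarrow> real^'n \<Rightarrow> real" where
  "partial i \<phi> x \<equiv> frechet_derivative \<phi> (at x) (axis i 1)"

primrec Ck :: "nat \<Rightarrow> (real^'n \<Rightarrow> real) \<Rightarrow> bool" where
  "Ck 0 \<phi> \<longleftrightarrow> continuous_on UNIV \<phi>"
| "Ck (Suc k) \<phi> \<longleftrightarrow> \<phi> differentiable_on UNIV \<and> (\<forall>i. Ck k (partial i \<phi>))"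

text \<open>Smooth functions on the torus, as smooth functions on the whole space that are
  \<open>2\<pi>\<close>-periodic in each coordinate.\<close>

definition test_function :: "(real^'n \<Rightarrow> real) \<Rightarrow> bool" where
  "test_function \<phi> \<longleftrightarrow> (\<forall>k. Ck k \<phi>) \<and> (\<forall>i x. \<phi> (x + axis i (2 * pi)) = \<phi> x)"

text \<open>\<open>weak_partial i f g\<close>: the vector field \<open>g\<close> is the weak partial derivative of the
  vector field \<open>f\<close> in the \<open>i\<close>-th coordinate direction, on the torus.\<close>

definition weak_partial :: "'n \<Rightarrow> (real^'n \<Rightarrow> real^'n) \<Rightarrow> (real^'n \<Rightarrow> real^'n) \<Rightarrow> bool" where
  "weak_partial i f g \<longleftrightarrow> f \<in> L2_torus \<and> g \<in> L2_torus \<and>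
     (\<forall>\<phi>. test_function \<phi> \<longrightarrow>
        (LINT x|torus. partial i \<phi> x *\<^sub>R f x) = - (LINT x|torus. \<phi> x *\<^sub>R g x))"

text \<open>Time-dependent fields \<open>u :: real \<Rightarrow> real^'n \<Rightarrow> real^'n\<close> take time first; only \<open>t \<ge> 0\<close>
  matters. \<open>continuous_in s u\<close> says that \<open>u\<close> lies in \<open>C([0,\<infinity>); H\<^sup>s)\<close>, and \<open>time_derivative s u u'\<close>
  that \<open>u'\<close> is its time derivative in the norm of \<open>H\<^sup>s\<close> (one-sided at \<open>t = 0\<close>).\<close>

definition continuous_in :: "real \<Rightarrow> (real \<Rightarrow> real^'n \<Rightarrow> real^'n) \<Rightarrow> bool" where
  "continuous_in s u \<longleftrightarrow> (\<forall>t\<ge>0. u t \<in> sobolev s) \<and>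
     (\<forall>t\<ge>0. ((\<lambda>\<tau>. sobolev_norm s (\<lambda>x. u \<tau> x - u t x)) \<longlongrightarrow> 0) (at t within {0..}))"

definition time_derivative ::
    "real \<Rightarrow> (real \<Rightarrow> real^'n \<Rightarrow> real^'n) \<Rightarrow> (real \<Rightarrow> real^'n \<Rightarrow> real^'n) \<Rightarrow> bool" where
  "time_derivative s u u' \<longleftrightarrow>
     (\<forall>t\<ge>0. ((\<lambda>\<tau>. sobolev_norm s (\<lambda>x. (u \<tau> x - u t x) /\<^sub>R (\<tau> - t) - u' t x)) \<longlongrightarrow> 0)
        (at t within {0..}))"

text \<open>Solutions in \<open>C([0,\<infinity>); H\<^sup>m) \<inter> C\<^sup>1([0,\<infinity>); H\<^sup>m\<^sup>-\<^sup>1)\<close>, the equations holding almost everywhere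
  on the torus at each time. \<open>Vt\<close>, \<open>Ht\<close> are the time derivatives, and \<open>DV t i\<close>, \<open>DH t i\<close> the
  \<open>i\<close>-th weak partial derivatives, of \<open>V\<close>, \<open>H\<close>.\<close>

definition solution ::
    "nat \<Rightarrow> real^'n \<Rightarrow> (real^'n \<Rightarrow> real^'n) \<Rightarrow> (real^'n \<Rightarrow> real^'n) \<Rightarrow>
     (real \<Rightarrow> real^'n \<Rightarrow> real^'n) \<Rightarrow> (real \<Rightarrow> real^'n \<Rightarrow> real^'n) \<Rightarrow> bool" where
  "solution m b V0 H0 V H \<longleftrightarrow>
     continuous_in (real m) V \<and> continuous_in (real m) H \<and>
     (\<exists>Vt Ht DV DH.
        continuous_in (real m - 1) Vt \<and> time_derivative (real m - 1) V Vt \<and>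
        continuous_in (real m - 1) Ht \<and> time_derivative (real m - 1) H Ht \<and>
        (\<forall>t\<ge>0. (\<forall>i. weak_partial i (V t) (DV t i) \<and> weak_partial i (H t) (DH t i)) \<and>
          (AE x in torus. Vt t x + V t x = (\<Sum>i\<in>UNIV. b $ i *\<^sub>R DH t i x)) \<and>
          (AE x in torus. Ht t x = (\<Sum>i\<in>UNIV. b $ i *\<^sub>R DV t i x)) \<and>
          (AE x in torus. (\<Sum>i\<in>UNIV. DV t i x $ i) = 0) \<and>
          (AE x in torus. (\<Sum>i\<in>UNIV. DH t i x $ i) = 0))) \<and>
     (AE x in torus. V 0 x = V0 x) \<and> (AE x in torus. H 0 x = H0 x)"

end

theory Submission
  imports Defs
begin

text \<open>
  Taking Fourier coefficients turns the system into a family of linear ordinary differential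
  equations, one for every frequency \<open>k\<close>. With \<open>\<omega> = b \<bullet> k\<close>, \<open>v = V\<^sub>k\<close> and \<open>g = i H\<^sub>k\<close> the equations read
  \<open>v' = \<omega> g - v\<close> and \<open>g' = - \<omega> v\<close>: an oscillator of which only one component is damped. This
  reduction is the lemma \<open>solution_fourier_ode\<close>; it rests on testing the weak derivatives
  against sines and cosines and on the fact that a single coefficient is a continuous linear
  functional on each Sobolev space.

  The energy \<open>|v|\<^sup>2 + |g|\<^sup>2\<close> dissipates only through \<open>v\<close>. Subtracting a small multiple
  of \<open>v \<bullet> g\<close> gives an equivalent functional that dissipates through both components, at the rate
  \<open>\<mu> \<sim> \<omega>\<^sup>2 / (1 + \<omega>\<^sup>2)\<close> (lemma \<open>energy_decay\<close>); the same argument covers the underdamped, critical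
  and overdamped regimes, so the eigenvalues never have to be computed. The damped component
  gains a further factor: after an initial layer, \<open>v\<close> follows \<open>\<omega> g\<close>, and
  \<open>\<omega>\<^sup>2 e^{- \<mu> t} \<lesssim> e^{- \<mu> t / 2} / (1 + t)\<close> for small \<open>\<omega>\<close>, while for large \<open>\<omega>\<close> the rate \<open>\<mu>\<close> is bounded below
  (lemma \<open>damped_component_decay\<close>). This is the additional \<open>(1 + t)\<^bsup>-1/2\<^esup>\<close> in the bound for \<open>V\<close>.

  The Diophantine condition bounds \<open>\<mu>\<close> from below by a multiple of \<open>X\<^bsup>-r\<^esup>\<close>, where \<open>X = 1 + |k|\<^sup>2\<close> is the
  Sobolev weight. This lower bound degenerates at high frequencies, and derivatives have to be spent
  for a uniform rate: \<open>X\<^bsup>-\<sigma>\<^esup> e^{- a t X^{-r}} \<lesssim> (1 + t)\<^bsup>-\<sigma>/r\<^esup>\<close> with \<open>\<sigma> = m - s\<close>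
  (lemma \<open>derivative_loss_decay\<close>). The frequency \<open>0\<close>, to which the Diophantine condition does not
  apply, is absent because the data are mean free. Summing the resulting bounds over \<open>k\<close>
  gives the Sobolev estimates.
\<close>

section \<open>Energy estimates for a partially damped oscillator\<close>

lemma le_initial_value:
  fixes f :: "real \<Rightarrow> real"
  assumes der: "\<And>t. t \<ge> 0 \<Longrightarrow> (f has_real_derivative f' t) (at t within {0..})"
    and nonpos: "\<And>t. t \<ge> 0 \<Longrightarrow> f' t \<le> 0" and "t \<ge> 0"
  shows "f t \<le> f 0"
proof (rule DERIV_nonpos_imp_decreasing_open[OF \<open>t \<ge> 0\<close>])
  show "\<exists>y. (f has_real_derivative y) (at x) \<and> y \<le> 0" if "0 < x" "x < t" for x
  proof -
    have "at x within {0..} = at x"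
      using that by (intro at_within_interior) (simp add: interior_Ici[of "-1"])
    then show ?thesis using der[of x] nonpos[of x] that by auto
  qed
  show "continuous_on {0..t} f"
    unfolding continuous_on_eq_continuous_within
  proof
    fix x assume "x \<in> {0..t}"
    then have "continuous (at x within {0..}) f"
      using DERIV_continuous[OF der[of x]] by simp
    then show "continuous (at x within {0..t}) f"
      by (rule continuous_within_subset) auto
  qed
qed

text \<open>
  The constant \<open>2/5\<close> is the one that the corrected energy functional below yields: it dissipates
  \<open>\<omega>\<^sup>2 / (2 (1 + \<omega>\<^sup>2))\<close> times the energy and is at most \<open>5/4\<close> of the energy.
\<close>

definition damping_rate :: "real \<Rightarrow> real" where
  "damping_rate \<omega> = 2 / 5 * (\<omega>\<^sup>2 / (1 + \<omega>\<^sup>2))"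

lemma damping_rate_nonneg: "0 \<le> damping_rate \<omega>"
  by (simp add: damping_rate_def)

lemma damping_rate_le: "damping_rate \<omega> \<le> 2 / 5"
proof -
  have "\<omega>\<^sup>2 / (1 + \<omega>\<^sup>2) \<le> 1" by (rule divide_le_eq_1[THEN iffD2]) (simp add: add_pos_nonneg)
  then show ?thesis unfolding damping_rate_def by linarith
qed

text \<open>
  The energy itself satisfies only \<open>E' = - 2 |v|\<^sup>2\<close>, which says nothing when \<open>v\<close> vanishes. The
  correction \<open>- 2 \<delta> (v \<bullet> g)\<close> contributes \<open>- 2 \<delta> \<omega> |g|\<^sup>2\<close> to the derivative, at the price of terms that
  \<open>- 2 |v|\<^sup>2\<close> absorbs if \<open>\<delta>\<close> is of the size \<open>\<omega> / (1 + \<omega>\<^sup>2)\<close>. The correction is at most a quarter of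
  the energy, hence the factor \<open>(5/4) / (3/4) = 5/3\<close>.
\<close>

lemma energy_decay:
  fixes v g :: "real \<Rightarrow> 'a::real_inner"
  assumes v: "\<And>t. t \<ge> 0 \<Longrightarrow> (v has_vector_derivative (\<omega> *\<^sub>R g t - v t)) (at t within {0..})"
    and g: "\<And>t. t \<ge> 0 \<Longrightarrow> (g has_vector_derivative (- (\<omega> *\<^sub>R v t))) (at t within {0..})"
    and "t \<ge> 0"
  shows "(norm (v t))\<^sup>2 + (norm (g t))\<^sup>2
    \<le> 5 / 3 * exp (- (damping_rate \<omega> * t)) * ((norm (v 0))\<^sup>2 + (norm (g 0))\<^sup>2)"
proof -
  define \<delta> where "\<delta> = \<omega> / (2 * (1 + \<omega>\<^sup>2))"
  define \<mu> where "\<mu> = damping_rate \<omega>"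
  define E where "E s = v s \<bullet> v s + g s \<bullet> g s" for s
  define L where "L s = E s - 2 * \<delta> * (v s \<bullet> g s)" for s
  define L' where "L' s = - 2 * (v s \<bullet> v s) + 2 * \<delta> * \<omega> * (v s \<bullet> v s)
      - 2 * \<delta> * \<omega> * (g s \<bullet> g s) + 2 * \<delta> * (v s \<bullet> g s)" for s
  have pos: "0 < 1 + \<omega>\<^sup>2" by (simp add: add_pos_nonneg)
  have \<mu>_eq: "\<mu> = 4 / 5 * (\<delta> * \<omega>)"
    using pos by (simp add: \<mu>_def damping_rate_def \<delta>_def power2_eq_square divide_simps)
  have \<delta>\<omega>: "0 \<le> \<delta> * \<omega>" "\<delta> * \<omega> \<le> 1 / 2"
    using pos by (auto simp: \<delta>_def field_simps power2_eq_square)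
  have \<delta>_sq: "2 * \<delta>\<^sup>2 \<le> \<delta> * \<omega>"
  proof -
    have "2 * (1 + \<omega>\<^sup>2) * \<delta> = \<omega>" using pos by (simp add: \<delta>_def)
    then have "2 * \<delta>\<^sup>2 = (\<delta> * \<omega>) * (1 / (1 + \<omega>\<^sup>2))"
      using pos by (simp add: power2_eq_square[of \<delta>] field_simps)
    also have "\<dots> \<le> (\<delta> * \<omega>) * 1"
      using pos \<delta>\<omega> by (intro mult_left_mono) auto
    finally show ?thesis by simp
  qed
  have \<delta>_abs: "\<bar>\<delta>\<bar> \<le> 1 / 4"
  proof -
    have "0 \<le> (1 - \<bar>\<omega>\<bar>)\<^sup>2" by simp
    then have "2 * \<bar>\<omega>\<bar> \<le> 1 + \<omega>\<^sup>2" by (simp add: power2_diff)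
    then show ?thesis using pos by (simp add: \<delta>_def abs_mult field_simps)
  qed
  have cross: "\<bar>2 * \<delta> * (v s \<bullet> g s)\<bar> \<le> E s / 4" for s
  proof -
    have "0 \<le> (v s - g s) \<bullet> (v s - g s)" "0 \<le> (v s + g s) \<bullet> (v s + g s)" by auto
    then have "2 * \<bar>v s \<bullet> g s\<bar> \<le> E s"
      by (auto simp: E_def inner_diff inner_add inner_commute)
    then have "\<bar>\<delta>\<bar> * (2 * \<bar>v s \<bullet> g s\<bar>) \<le> 1 / 4 * E s"
      using \<delta>_abs by (intro mult_mono) auto
    then show ?thesis by (simp add: abs_mult)
  qed
  \<comment> \<open>the point of the construction: \<open>L\<close> decays at the rate \<open>\<mu>\<close>\<close>
  have diss: "L' s + \<mu> * L s \<le> 0" for s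
  proof -
    define A B where "A = v s \<bullet> v s" and "B = g s \<bullet> g s"
    have [simp]: "0 \<le> A" "0 \<le> B" by (auto simp: A_def B_def)
    \<comment> \<open>Young's inequality, written as the square of \<open>v - 2 \<delta> g\<close>\<close>
    have "0 \<le> (v s - (2 * \<delta>) *\<^sub>R g s) \<bullet> (v s - (2 * \<delta>) *\<^sub>R g s)" by simp
    then have 1: "2 * \<delta> * (v s \<bullet> g s) \<le> A / 2 + 2 * \<delta>\<^sup>2 * B"
      by (simp add: A_def B_def inner_diff inner_commute power2_eq_square)
    have 2: "2 * \<delta>\<^sup>2 * B \<le> \<delta> * \<omega> * B"
      using \<delta>_sq by (intro mult_right_mono) auto
    have 3: "\<delta> * \<omega> * A \<le> 1 / 2 * A"
      using \<delta>\<omega> by (intro mult_right_mono) auto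
    have "L' s \<le> - (\<delta> * \<omega>) * E s"
      using 1 2 3 by (simp add: L'_def E_def A_def[symmetric] B_def[symmetric] algebra_simps)
    moreover have "\<mu> * L s \<le> \<mu> * (5 / 4 * E s)"
      using cross[of s] \<delta>\<omega> by (intro mult_left_mono) (auto simp: \<mu>_eq L_def abs_le_iff)
    ultimately show ?thesis by (simp add: \<mu>_eq)
  qed
  have derL: "(L has_real_derivative L' s) (at s within {0..})" if "s \<ge> 0" for s
    unfolding L_def E_def has_real_derivative_iff_has_vector_derivative L'_def
    by (rule derivative_eq_intros v[OF that] g[OF that]
        bounded_bilinear.has_vector_derivative[OF bounded_bilinear_inner] refl)+
       (simp add: inner_diff inner_commute algebra_simps)
  have "exp (\<mu> * t) * L t \<le> exp (\<mu> * 0) * L 0"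
  proof (rule le_initial_value[OF _ _ \<open>t \<ge> 0\<close>])
    show "((\<lambda>s. exp (\<mu> * s) * L s) has_real_derivative exp (\<mu> * s) * (L' s + \<mu> * L s)) (at s within {0..})"
      if "s \<ge> 0" for s
      by (rule derivative_eq_intros derL[OF that] refl)+ (simp add: algebra_simps)
    show "exp (\<mu> * s) * (L' s + \<mu> * L s) \<le> 0" if "s \<ge> 0" for s
      using diss[of s] by (simp add: mult_nonneg_nonpos)
  qed
  then have "L t \<le> exp (- (\<mu> * t)) * L 0"
    by (simp add: exp_minus field_simps)
  moreover have "3 / 4 * E t \<le> L t" "L 0 \<le> 5 / 4 * E 0"
    using cross[of t] cross[of 0] by (auto simp: L_def abs_le_iff)
  moreover have "exp (- (\<mu> * t)) * L 0 \<le> exp (- (\<mu> * t)) * (5 / 4 * E 0)"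
    using calculation by (intro mult_left_mono) auto
  ultimately have "E t \<le> 5 / 3 * exp (- (\<mu> * t)) * E 0" by linarith
  then show ?thesis by (simp add: E_def \<mu>_def power2_norm_eq_inner)
qed

text \<open>
  For small \<open>\<omega>\<close> the component \<open>v\<close> relaxes at unit rate towards the forcing \<open>\<omega> g\<close>, so that
  \<open>|v|\<^sup>2\<close> is at most the initial energy times a multiple of \<open>e\<^bsup>-t\<^esup> + \<omega>\<^sup>2 e\<^bsup>-\<mu>t\<^esup>\<close>; as \<open>\<omega>\<^sup>2 \<le> 5 \<mu>\<close>, half of the exponential turns \<open>\<omega>\<^sup>2\<close> into
  \<open>1 / (1 + t)\<close>. For large \<open>\<omega>\<close> the rate is at least \<open>1/5\<close> and half of the exponential is already
  enough.
\<close>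

lemma damped_component_decay:
  fixes v g :: "real \<Rightarrow> 'a::real_inner"
  assumes v: "\<And>t. t \<ge> 0 \<Longrightarrow> (v has_vector_derivative (\<omega> *\<^sub>R g t - v t)) (at t within {0..})"
    and g: "\<And>t. t \<ge> 0 \<Longrightarrow> (g has_vector_derivative (- (\<omega> *\<^sub>R v t))) (at t within {0..})"
    and "t \<ge> 0"
  shows "(1 + t) * (norm (v t))\<^sup>2
    \<le> 30 * exp (- (damping_rate \<omega> * t / 2)) * ((norm (v 0))\<^sup>2 + (norm (g 0))\<^sup>2)"
proof -
  define \<mu> where "\<mu> = damping_rate \<omega>"
  define E0 where "E0 = (norm (v 0))\<^sup>2 + (norm (g 0))\<^sup>2"
  have [simp]: "0 \<le> E0" by (simp add: E0_def)
  have \<mu>: "0 \<le> \<mu>" "\<mu> \<le> 2 / 5"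
    using damping_rate_nonneg[of \<omega>] damping_rate_le[of \<omega>] by (auto simp: \<mu>_def)
  have E: "(norm (v s))\<^sup>2 + (norm (g s))\<^sup>2 \<le> 5 / 3 * exp (- (\<mu> * s)) * E0" if "s \<ge> 0" for s
    using energy_decay[OF v g that] by (simp add: \<mu>_def E0_def)
  have exp_half: "exp (- (\<mu> * t)) = exp (- (\<mu> * t / 2)) * exp (- (\<mu> * t / 2))"
    by (simp flip: exp_add)
  have exp_le: "exp (- x) \<le> 1 / (1 + x)" if "0 \<le> x" for x :: real
    using exp_ge_add_one_self[of x] that by (simp add: exp_minus field_simps)
  show ?thesis
  proof (cases "\<omega>\<^sup>2 \<le> 1")
    case True
    have \<omega>\<mu>: "\<omega>\<^sup>2 \<le> 5 * \<mu>"
    proof -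
      have "\<omega>\<^sup>2 * (1 + \<omega>\<^sup>2) \<le> \<omega>\<^sup>2 * 2" using True by (intro mult_left_mono) auto
      moreover have "0 < 1 + \<omega>\<^sup>2" by (simp add: add_pos_nonneg)
      ultimately have "\<omega>\<^sup>2 \<le> 2 * (\<omega>\<^sup>2 / (1 + \<omega>\<^sup>2))" by (simp add: field_simps)
      then show ?thesis unfolding \<mu>_def damping_rate_def by linarith
    qed
    define K where "K = 25 / 9 * \<omega>\<^sup>2 * E0"
    have "0 \<le> K" by (simp add: K_def)
    \<comment> \<open>Duhamel's formula in differential form: the derivative of \<open>K e^{(1-\<mu>)s}\<close> majorizes the forcing;
      \<open>25/9\<close> is the energy constant \<open>5/3\<close> divided by the lower bound \<open>3/5\<close> for \<open>1 - \<mu>\<close>\<close>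
    have "exp t * (v t \<bullet> v t) - K * exp ((1 - \<mu>) * t) \<le> exp 0 * (v 0 \<bullet> v 0) - K * exp ((1 - \<mu>) * 0)"
    proof (rule le_initial_value[OF _ _ \<open>t \<ge> 0\<close>])
      fix s :: real assume s: "s \<ge> 0"
      have [derivative_intros]:
        "((\<lambda>s. v s \<bullet> v s) has_real_derivative 2 * (v s \<bullet> (\<omega> *\<^sub>R g s - v s))) (at s within {0..})"
        unfolding has_real_derivative_iff_has_vector_derivative
        by (rule bounded_bilinear.has_vector_derivative[OF bounded_bilinear_inner v[OF s] v[OF s],
              THEN has_vector_derivative_eq_rhs]) (simp add: inner_commute)
      show "((\<lambda>s. exp s * (v s \<bullet> v s) - K * exp ((1 - \<mu>) * s)) has_real_derivative
         exp s * (2 * \<omega> * (v s \<bullet> g s) - v s \<bullet> v s) - K * (1 - \<mu>) * exp ((1 - \<mu>) * s)) (at s within {0..})"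
        by (rule derivative_eq_intros refl)+ (simp add: inner_diff algebra_simps)
      have "0 \<le> (v s - \<omega> *\<^sub>R g s) \<bullet> (v s - \<omega> *\<^sub>R g s)" by simp
      then have "2 * \<omega> * (v s \<bullet> g s) - v s \<bullet> v s \<le> \<omega>\<^sup>2 * (g s \<bullet> g s)"
        by (simp add: inner_diff inner_commute power2_eq_square algebra_simps)
      also have "\<dots> \<le> \<omega>\<^sup>2 * (5 / 3 * exp (- (\<mu> * s)) * E0)"
      proof (intro mult_left_mono)
        show "g s \<bullet> g s \<le> 5 / 3 * exp (- (\<mu> * s)) * E0"
          using E[OF s] zero_le_power2[of "norm (v s)"] unfolding power2_norm_eq_inner by linarith
      qed simp
      also have "\<dots> = K * (3 / 5) * exp (- (\<mu> * s))" by (simp add: K_def)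
      also have "\<dots> \<le> K * (1 - \<mu>) * exp (- (\<mu> * s))"
        using \<mu> \<open>0 \<le> K\<close> by (intro mult_right_mono mult_left_mono) auto
      finally have "exp s * (2 * \<omega> * (v s \<bullet> g s) - v s \<bullet> v s)
          \<le> exp s * (K * (1 - \<mu>) * exp (- (\<mu> * s)))"
        by (intro mult_left_mono) auto
      also have "\<dots> = K * (1 - \<mu>) * exp ((1 - \<mu>) * s)"
        by (simp add: algebra_simps flip: exp_add)
      finally show "exp s * (2 * \<omega> * (v s \<bullet> g s) - v s \<bullet> v s) - K * (1 - \<mu>) * exp ((1 - \<mu>) * s) \<le> 0"
        by simp
    qed
    then have "exp t * (v t \<bullet> v t) \<le> E0 + K * exp ((1 - \<mu>) * t)"
      using \<open>0 \<le> K\<close> inner_ge_zero[of "g 0"] unfolding E0_def power2_norm_eq_inner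
      by (simp del: inner_ge_zero)
    then have "exp (- t) * (exp t * (v t \<bullet> v t)) \<le> exp (- t) * (E0 + K * exp ((1 - \<mu>) * t))"
      by (intro mult_left_mono) auto
    moreover have "exp (- t) * (exp t * (v t \<bullet> v t)) = v t \<bullet> v t"
      by (simp add: exp_minus)
    moreover have prod2: "exp (- t) * exp ((1 - \<mu>) * t) = exp (- (\<mu> * t))"
      by (simp add: algebra_simps flip: exp_add)
    then have "exp (- t) * (E0 + K * exp ((1 - \<mu>) * t)) = exp (- t) * E0 + K * exp (- (\<mu> * t))"
      unfolding distrib_left by (metis mult.left_commute)
    ultimately have "v t \<bullet> v t \<le> exp (- t) * E0 + K * exp (- (\<mu> * t))" by linarith
    then have "(norm (v t))\<^sup>2 \<le> (exp (- t) + 25 / 9 * \<omega>\<^sup>2 * exp (- (\<mu> * t))) * E0"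
      unfolding power2_norm_eq_inner K_def by (simp add: algebra_simps)
    then have "(1 + t) * (norm (v t))\<^sup>2 \<le> (1 + t) * ((exp (- t) + 25 / 9 * \<omega>\<^sup>2 * exp (- (\<mu> * t))) * E0)"
      using \<open>t \<ge> 0\<close> by (intro mult_left_mono) auto
    also have "\<dots> = ((1 + t) * exp (- t) + 25 / 9 * ((1 + t) * \<omega>\<^sup>2 * exp (- (\<mu> * t)))) * E0"
      by (simp add: algebra_simps)
    also have "\<dots> \<le> (2 * exp (- (\<mu> * t / 2)) + 25 / 9 * (10 * exp (- (\<mu> * t / 2)))) * E0"
    proof (intro mult_right_mono add_mono mult_left_mono)
      have "exp (- t) = exp (- (t / 2)) * exp (- (t / 2))" by (simp flip: exp_add)
      also have "\<dots> \<le> 1 / (1 + t / 2) * exp (- (\<mu> * t / 2))"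
        using \<mu> \<open>t \<ge> 0\<close> exp_le[of "t / 2"] by (intro mult_mono) (auto intro: mult_left_le_one_le)
      finally have "(1 + t) * exp (- t) \<le> (1 + t) * (1 / (1 + t / 2) * exp (- (\<mu> * t / 2)))"
        using \<open>t \<ge> 0\<close> by (intro mult_left_mono) auto
      also have "\<dots> = ((1 + t) / (1 + t / 2)) * exp (- (\<mu> * t / 2))" by simp
      also have "\<dots> \<le> 2 * exp (- (\<mu> * t / 2))"
        using \<open>t \<ge> 0\<close> by (intro mult_right_mono) (auto simp: field_simps)
      finally show "(1 + t) * exp (- t) \<le> 2 * exp (- (\<mu> * t / 2))" .
      have "(1 + t) * \<omega>\<^sup>2 \<le> (1 + t) * (5 * \<mu>)"
        using \<open>t \<ge> 0\<close> \<omega>\<mu> by (intro mult_left_mono) auto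
      also have "\<dots> \<le> 10 * (1 + \<mu> * t / 2)"
        using \<mu> by (simp add: algebra_simps)
      finally have "(1 + t) * \<omega>\<^sup>2 * exp (- (\<mu> * t / 2)) \<le> 10 * (1 + \<mu> * t / 2) * (1 / (1 + \<mu> * t / 2))"
        using \<mu> \<open>t \<ge> 0\<close> exp_le[of "\<mu> * t / 2"] by (intro mult_mono[of "(1 + t) * \<omega>\<^sup>2"]) auto
      also have "\<dots> = 10"
        using mult_nonneg_nonneg[OF \<mu>(1) \<open>t \<ge> 0\<close>] by (simp add: field_simps)
      finally have "(1 + t) * \<omega>\<^sup>2 * exp (- (\<mu> * t / 2)) * exp (- (\<mu> * t / 2)) \<le> 10 * exp (- (\<mu> * t / 2))"
        by (intro mult_right_mono) auto
      then show "(1 + t) * \<omega>\<^sup>2 * exp (- (\<mu> * t)) \<le> 10 * exp (- (\<mu> * t / 2))"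
        by (simp add: exp_half mult.assoc)
    qed auto
    also have "\<dots> \<le> 30 * exp (- (\<mu> * t / 2)) * E0"
      by (simp add: mult_right_mono flip: distrib_right)
    finally show ?thesis by (simp add: \<mu>_def E0_def)
  next
    case False
    then have \<mu>5: "1 / 5 \<le> \<mu>"
      using add_pos_nonneg[OF zero_less_one zero_le_power2[of \<omega>]]
      unfolding \<mu>_def damping_rate_def by (simp add: divide_simps)
    have "exp (- (\<mu> * t / 2)) \<le> exp (- (t / 10))"
      using \<mu>5 \<open>t \<ge> 0\<close> mult_right_mono[OF \<mu>5 \<open>t \<ge> 0\<close>] by simp
    also have "\<dots> \<le> 1 / (1 + t / 10)" using \<open>t \<ge> 0\<close> exp_le[of "t / 10"] by simp
    also have "\<dots> \<le> 10 / (1 + t)" using \<open>t \<ge> 0\<close> by (simp add: field_simps)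
    finally have *: "(1 + t) * exp (- (\<mu> * t / 2)) \<le> 10" using \<open>t \<ge> 0\<close> by (simp add: field_simps)
    have "(norm (v t))\<^sup>2 \<le> 5 / 3 * exp (- (\<mu> * t)) * E0"
      using E[OF \<open>t \<ge> 0\<close>] zero_le_power2[of "norm (g t)"] by linarith
    then have "(1 + t) * (norm (v t))\<^sup>2 \<le> (1 + t) * (5 / 3 * exp (- (\<mu> * t)) * E0)"
      using \<open>t \<ge> 0\<close> by (intro mult_left_mono) auto
    also have "\<dots> = 5 / 3 * (((1 + t) * exp (- (\<mu> * t / 2))) * (exp (- (\<mu> * t / 2)) * E0))"
      by (simp add: exp_half)
    also have "\<dots> \<le> 5 / 3 * (10 * (exp (- (\<mu> * t / 2)) * E0))"
      using * by (intro mult_left_mono mult_right_mono) auto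
    also have "\<dots> \<le> 30 * exp (- (\<mu> * t / 2)) * E0" by simp
    finally show ?thesis by (simp add: \<mu>_def E0_def)
  qed
qed

section \<open>Trading regularity for time decay\<close>

text \<open>
  In terms of \<open>z = (1 + t) X\<^bsup>-r\<^esup>\<close> the claim is that \<open>z\<^bsup>\<sigma>/r\<^esup> e\<^bsup>-az\<^esup>\<close> is bounded, because \<open>a t X\<^bsup>-r\<^esup>\<close> and
  \<open>a z\<close> differ by at most \<open>a\<close>. Replacing \<open>z\<^bsup>\<sigma>/r\<^esup>\<close> by \<open>(1 + z)\<^bsup>N\<^esup>\<close> with a fixed integer \<open>N \<ge> M / r\<close> makes the
  constant uniform in \<open>\<sigma>\<close>.
\<close>

lemma derivative_loss_decay:
  fixes a r M :: real
  assumes "a > 0" "r > 0" "M \<ge> 0"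
  shows "\<exists>K\<ge>1. \<forall>X\<ge>1. \<forall>t\<ge>0. \<forall>\<sigma>. 0 \<le> \<sigma> \<and> \<sigma> \<le> M \<longrightarrow>
     exp (- (a * t * X powr (- r))) * X powr (- \<sigma>) \<le> K * (1 + t) powr (- (\<sigma> / r))"
proof -
  define N where "N = nat \<lceil>M / r\<rceil>"
  define K where "K = max 1 (fact N / a ^ N * exp (2 * a))"
  have "exp (- (a * t * X powr (- r))) * X powr (- \<sigma>) \<le> K * (1 + t) powr (- (\<sigma> / r))"
    if "X \<ge> 1" "t \<ge> 0" "0 \<le> \<sigma>" "\<sigma> \<le> M" for X t \<sigma> :: real
  proof -
    define z where "z = (1 + t) * X powr (- r)"
    have z: "z \<ge> 0" using that by (simp add: z_def)
    have "X powr (- r) \<le> 1"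
      using that assms powr_mono[of "- r" 0 X] by simp
    then have *: "a * z - a \<le> a * t * X powr (- r)"
      using \<open>a > 0\<close> by (simp add: z_def algebra_simps)
    have "\<sigma> / r \<le> M / r" using that assms by (simp add: divide_right_mono)
    also have "\<dots> \<le> real N" unfolding N_def by linarith
    finally have le: "\<sigma> / r \<le> real N" .
    have "z powr (\<sigma> / r) \<le> (1 + z) powr (\<sigma> / r)"
      using z that assms by (intro powr_mono2) auto
    also have "\<dots> \<le> (1 + z) powr real N"
      using z le by (intro powr_mono) auto
    also have "\<dots> = (1 + z) ^ N" using z by (simp add: powr_realpow)
    also have "\<dots> \<le> fact N / a ^ N * exp (a * (1 + z))"
    proof -
      have "(a * (1 + z)) ^ N / fact N \<le> exp (a * (1 + z))"
      proof -
        \<comment> \<open>a single term of the exponential series\<close>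
        have "(\<Sum>n\<in>{N}. inverse (fact n) * (a * (1 + z)) ^ n) \<le> (\<Sum>n. inverse (fact n) * (a * (1 + z)) ^ n)"
          using z \<open>a > 0\<close> by (intro sum_le_suminf summable_exp) auto
        then show ?thesis by (simp add: exp_def divide_simps scaleR_conv_of_real)
      qed
      then show ?thesis using \<open>a > 0\<close> unfolding power_mult_distrib by (simp add: field_simps)
    qed
    finally have "exp (- (a * t * X powr (- r))) * z powr (\<sigma> / r)
       \<le> exp (a - a * z) * (fact N / a ^ N * exp (a * (1 + z)))"
      using * by (intro mult_mono) auto
    also have "\<dots> = fact N / a ^ N * exp (2 * a)"
      by (simp add: algebra_simps flip: exp_add)
    also have "\<dots> \<le> K" by (simp add: K_def)
    finally have **: "exp (- (a * t * X powr (- r))) * z powr (\<sigma> / r) \<le> K" .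
    have "z powr (\<sigma> / r) = (1 + t) powr (\<sigma> / r) * X powr (- \<sigma>)"
      using that assms by (simp add: z_def powr_mult powr_powr)
    then have "X powr (- \<sigma>) = z powr (\<sigma> / r) * (1 + t) powr (- (\<sigma> / r))"
      using that by (simp add: powr_minus field_simps)
    then show ?thesis
      using mult_right_mono[OF **, of "(1 + t) powr (- (\<sigma> / r))"] by (simp add: mult.assoc)
  qed
  then show ?thesis by (intro exI[of _ K]) (auto simp: K_def)
qed

section \<open>Fourier coefficients of fields on the torus\<close>

lemma finite_measure_torus: "finite_measure (torus :: (real^'n) measure)"
  by (intro finite_measureI) (simp add: emeasure_restrict_space emeasure_lborel_cbox_eq)

lemma L2_torus_measurable: "f \<in> L2_torus \<Longrightarrow> f \<in> borel_measurable torus"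
  by (simp add: L2_torus_def)

lemma L2_torus_integrable: 
  assumes "f \<in> L2_torus" shows "integrable torus f"
proof (rule Bochner_Integration.integrable_bound)
  show "integrable torus (\<lambda>x. 1 + (norm (f x))\<^sup>2)"
    using assms finite_measure.integrable_const[OF finite_measure_torus, of "1::real"]
    by (intro Bochner_Integration.integrable_add) (auto simp: L2_torus_def)
  have "norm (f x) \<le> 1 + (norm (f x))\<^sup>2" for x
    using zero_le_power2[of "norm (f x) - 1/2"] by (simp add: power2_diff power_divide)
  then show "AE x in torus. norm (f x) \<le> norm (1 + (norm (f x))\<^sup>2)" by simp
qed (use assms in \<open>simp add: L2_torus_def\<close>)

lemma continuous_torus_measurable:
  fixes f :: "real^'n \<Rightarrow> 'b::euclidean_space"
  assumes "continuous_on UNIV f" shows "f \<in> borel_measurable torus"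
  by (rule continuous_imp_measurable_on_sets_lebesgue[OF continuous_on_subset[OF assms]]) auto

lemma vec_nth_measurable:
  fixes f :: "'a \<Rightarrow> real^'n"
  assumes "f \<in> borel_measurable M"
  shows "(\<lambda>x. f x $ i) \<in> borel_measurable M"
  by (rule measurable_compose[OF assms])
     (intro borel_measurable_continuous_onI continuous_intros)

lemma character_integrable:
  assumes "integrable torus f"
  shows "integrable torus (\<lambda>x. cis (- (ivec k \<bullet> x)) * complex_of_real (f x $ i))"
proof (rule Bochner_Integration.integrable_bound[OF assms])
  have [measurable]: "(\<lambda>x. f x $ i) \<in> borel_measurable torus"
    using assms by (intro vec_nth_measurable) simp
  have "continuous_on UNIV (\<lambda>x. cis (- (ivec k \<bullet> x)))"
    unfolding cis_conv_exp by (intro continuous_intros)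
  from continuous_torus_measurable[OF this]
  have [measurable]: "(\<lambda>x. cis (- (ivec k \<bullet> x))) \<in> borel_measurable torus" .
  show "(\<lambda>x. cis (- (ivec k \<bullet> x)) * complex_of_real (f x $ i)) \<in> borel_measurable torus"
    by measurable
  show "AE x in torus. norm (cis (- (ivec k \<bullet> x)) * complex_of_real (f x $ i)) \<le> norm (f x)"
    by (simp add: norm_mult component_le_norm_cart)
qed

lemma fourier_coeff_add:
  assumes "integrable torus f" "integrable torus g"
  shows "fourier_coeff (\<lambda>x. f x + g x) k = fourier_coeff f k + fourier_coeff g k"
  using character_integrable[OF assms(1)] character_integrable[OF assms(2)]
  by (simp add: fourier_coeff_def vec_eq_iff algebra_simps add_divide_distrib)

lemma fourier_coeff_scaleR:
  assumes "integrable torus f"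
  shows "fourier_coeff (\<lambda>x. c *\<^sub>R f x) k = c *\<^sub>R fourier_coeff f k"
proof -
  have "(LINT x|torus. cis (- (ivec k \<bullet> x)) * complex_of_real (c * f x $ i)) =
        c *\<^sub>R (LINT x|torus. cis (- (ivec k \<bullet> x)) * complex_of_real (f x $ i))" for i
    by (subst integral_scaleR_right[symmetric])
       (auto simp: character_integrable[OF assms] scaleR_conv_of_real mult_ac)
  then have "fourier_coeff (\<lambda>x. c *\<^sub>R f x) k $ i = (c *\<^sub>R fourier_coeff f k) $ i" for i
    unfolding fourier_coeff_def vector_scaleR_component vec_lambda_beta real_scaleR_def
    by (simp only: scaleR_conv_of_real times_divide_eq_right)
  then show ?thesis by (auto intro: vec_eq_iff[THEN iffD2])
qed

lemma fourier_coeff_diff: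
  assumes "integrable torus f" "integrable torus g"
  shows "fourier_coeff (\<lambda>x. f x - g x) k = fourier_coeff f k - fourier_coeff g k"
  using character_integrable[OF assms(1)] character_integrable[OF assms(2)]
  by (simp add: fourier_coeff_def vec_eq_iff algebra_simps diff_divide_distrib)

lemma fourier_coeff_sum:
  assumes "finite I" "\<And>i. i \<in> I \<Longrightarrow> integrable torus (f i)"
  shows "fourier_coeff (\<lambda>x. \<Sum>i\<in>I. f i x) k = (\<Sum>i\<in>I. fourier_coeff (f i) k)"
  using assms
proof (induction rule: finite_induct)
  case empty
  then show ?case by (simp add: fourier_coeff_def vec_eq_iff)
next
  case (insert j I)
  then show ?case by (simp add: fourier_coeff_add)
qed

lemma fourier_coeff_cong_AE:
  assumes f: "f \<in> borel_measurable torus" and g: "g \<in> borel_measurable torus"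
    and eq: "AE x in torus. f x = g x"
  shows "fourier_coeff f k = fourier_coeff g k"
proof -
  have "continuous_on UNIV (\<lambda>x. cis (- (ivec k \<bullet> x)))"
    unfolding cis_conv_exp by (intro continuous_intros)
  from continuous_torus_measurable[OF this]
  have [measurable]: "(\<lambda>x. cis (- (ivec k \<bullet> x))) \<in> borel_measurable torus" .
  note [measurable] = f[THEN vec_nth_measurable] g[THEN vec_nth_measurable]
  have "(LINT x|torus. cis (- (ivec k \<bullet> x)) * complex_of_real (f x $ i)) =
        (LINT x|torus. cis (- (ivec k \<bullet> x)) * complex_of_real (g x $ i))" for i
    by (rule integral_cong_AE) (measurable, use eq in auto)
  then show ?thesis by (simp add: fourier_coeff_def)
qed

lemma fourier_coeff_zero_of_mean_zero:
  fixes f :: "real^'n \<Rightarrow> real^'n"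
  assumes "integrable torus f" "(LINT x|torus. f x) = 0"
  shows "fourier_coeff f 0 = 0"
proof -
  have "(LINT x|torus. f x $ i) = 0" for i
    using integral_bounded_linear[OF bounded_linear_vec_nth assms(1), of i] assms(2) by simp
  moreover have "ivec (0 :: int^'n) = 0" by (simp add: ivec_def vec_eq_iff)
  ultimately show ?thesis
    by (simp add: fourier_coeff_def vec_eq_iff[of _ "0 :: complex^'n"])
qed

lemma wave_has_derivative:
  "((\<lambda>x. a * cos (w \<bullet> x + \<theta>)) has_derivative (\<lambda>y. - (a * sin (w \<bullet> x + \<theta>)) * (w \<bullet> y))) (at x)"
  for w :: "'a::real_inner"
  by (auto intro!: derivative_eq_intros)

text \<open>
  Differentiation shifts the phase by a quarter period. Allowing an arbitrary phase keeps the
  family of waves closed under partial derivatives, so their smoothness follows by induction.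
\<close>

lemma partial_wave:
  "partial i (\<lambda>x. a * cos (w \<bullet> x + \<theta>)) = (\<lambda>x. (a * w $ i) * cos (w \<bullet> x + (\<theta> + pi / 2)))"
proof
  fix x
  have "partial i (\<lambda>x. a * cos (w \<bullet> x + \<theta>)) x = - (a * sin (w \<bullet> x + \<theta>)) * w $ i"
    by (simp add: frechet_derivative_at[OF wave_has_derivative, symmetric] inner_axis)
  also have "sin (w \<bullet> x + \<theta>) = - cos (w \<bullet> x + (\<theta> + pi / 2))"
    by (simp add: cos_add sin_add)
  finally show "partial i (\<lambda>x. a * cos (w \<bullet> x + \<theta>)) x = (a * w $ i) * cos (w \<bullet> x + (\<theta> + pi / 2))"
    by simp
qed

lemma Ck_wave: "Ck n (\<lambda>x. a * cos (w \<bullet> x + \<theta>))"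
proof (induction n arbitrary: a \<theta>)
  case 0
  show ?case by (auto intro!: continuous_intros)
next
  case (Suc n)
  have "(\<lambda>x. a * cos (w \<bullet> x + \<theta>)) differentiable_on UNIV"
    using wave_has_derivative unfolding differentiable_on_def differentiable_def by blast
  then show ?case using Suc by (simp add: partial_wave)
qed

lemma test_function_wave: "test_function (\<lambda>x. cos (ivec k \<bullet> x + \<theta>))"
proof -
  have "cos (ivec k \<bullet> (x + axis i (2 * pi)) + \<theta>) = cos (ivec k \<bullet> x + \<theta>)" for i x
  proof -
    have "ivec k \<bullet> (x + axis i (2 * pi)) + \<theta> = (ivec k \<bullet> x + \<theta>) + of_int (k $ i) * (2 * pi)"
      by (simp add: inner_add_right inner_axis ivec_def)
    moreover have "cos (y + of_int n * (2 * pi)) = cos y" for y n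
      by (simp add: cos_add mult.commute[of "of_int n"] cos_int_2pin sin_int_2pin)
    ultimately show ?thesis by metis
  qed
  then show ?thesis
    using Ck_wave[of _ 1 "ivec k" \<theta>] by (simp add: test_function_def)
qed

lemma fourier_coeff_component:
  fixes f :: "real^'n \<Rightarrow> real^'n"
  assumes "integrable torus f"
  shows "fourier_coeff f k $ j = (complex_of_real ((LINT x|torus. cos (ivec k \<bullet> x) *\<^sub>R f x) $ j)
     - \<i> * complex_of_real ((LINT x|torus. sin (ivec k \<bullet> x) *\<^sub>R f x) $ j)) / (2 * pi) ^ CARD('n)"
proof -
  have [measurable]: "f \<in> borel_measurable torus" using assms by simp
  have meas[measurable]: "(\<lambda>x. cos (ivec k \<bullet> x)) \<in> borel_measurable torus"
      "(\<lambda>x. sin (ivec k \<bullet> x)) \<in> borel_measurable torus"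
    by (intro continuous_torus_measurable continuous_intros)+
  have c: "integrable torus (\<lambda>x. cos (ivec k \<bullet> x) *\<^sub>R f x)"
    by (rule Bochner_Integration.integrable_bound[OF assms])
       (auto intro!: mult_left_le_one_le simp: abs_cos_le_one)
  have s: "integrable torus (\<lambda>x. sin (ivec k \<bullet> x) *\<^sub>R f x)"
    by (rule Bochner_Integration.integrable_bound[OF assms])
       (auto intro!: mult_left_le_one_le simp: abs_sin_le_one)
  note c' = integral_bounded_linear[OF bounded_linear_vec_nth c, of j, simplified]
    and s' = integral_bounded_linear[OF bounded_linear_vec_nth s, of j, simplified]
  note ci = integrable_bounded_linear[OF bounded_linear_vec_nth c, of j, simplified]
    and si = integrable_bounded_linear[OF bounded_linear_vec_nth s, of j, simplified]
  have "(LINT x|torus. cis (- (ivec k \<bullet> x)) * complex_of_real (f x $ j)) =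
     (LINT x|torus. complex_of_real (cos (ivec k \<bullet> x) * f x $ j) - \<i> * complex_of_real (sin (ivec k \<bullet> x) * f x $ j))"
    by (intro Bochner_Integration.integral_cong) (auto simp: complex_eq_iff)
  also have "\<dots> = complex_of_real (LINT x|torus. cos (ivec k \<bullet> x) * f x $ j)
     - \<i> * complex_of_real (LINT x|torus. sin (ivec k \<bullet> x) * f x $ j)"
    using ci si by (subst Bochner_Integration.integral_diff) (auto simp del: of_real_mult)
  finally show ?thesis by (simp add: fourier_coeff_def c' s')
qed

text \<open>
  Weak derivatives are defined by real test functions. Phase \<open>0\<close> gives the cosine and phase
  \<open>- \<pi>/2\<close> the sine; together they yield the complex exponential.
\<close>

lemma fourier_coeff_weak_partial:
  assumes "weak_partial i f g"
  shows "fourier_coeff g k $ j = \<i> * of_int (k $ i) * fourier_coeff f k $ j"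
proof -
  have f: "integrable torus f" and g: "integrable torus g"
    using assms by (auto simp: weak_partial_def L2_torus_integrable)
  have test: "(LINT x|torus. partial i (\<lambda>x. cos (ivec k \<bullet> x + \<theta>)) x *\<^sub>R f x)
      = - (LINT x|torus. cos (ivec k \<bullet> x + \<theta>) *\<^sub>R g x)" for \<theta>
    using assms test_function_wave[of k \<theta>] unfolding weak_partial_def by blast
  have part: "partial i (\<lambda>x. cos (ivec k \<bullet> x + \<theta>)) = (\<lambda>x. of_int (k $ i) * cos (ivec k \<bullet> x + \<theta> + pi / 2))" for \<theta>
    using partial_wave[where i = i and a = 1 and w = "ivec k" and \<theta> = \<theta>] by (simp add: ivec_def add.assoc)
  have cos1: "cos (y + pi / 2) = - sin y" and cos2: "cos (y + - (pi / 2)) = sin y" for y :: real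
    using cos_add[of y "pi / 2"] cos_add[of y "- (pi / 2)"] by simp_all
  have cancel: "y + - (pi / 2) + pi / 2 = y" for y :: real by simp
  have e1: "of_int (k $ i) *\<^sub>R (LINT x|torus. sin (ivec k \<bullet> x) *\<^sub>R f x) = (LINT x|torus. cos (ivec k \<bullet> x) *\<^sub>R g x)"
    using test[of 0] unfolding fun_cong[OF part] cos1 by (simp flip: scaleR_scaleR)
  have e2: "of_int (k $ i) *\<^sub>R (LINT x|torus. cos (ivec k \<bullet> x) *\<^sub>R f x) = - (LINT x|torus. sin (ivec k \<bullet> x) *\<^sub>R g x)"
    using test[of "- (pi / 2)"] unfolding fun_cong[OF part] unfolding cancel cos2 by (simp flip: scaleR_scaleR)
  have Cg: "(LINT x|torus. cos (ivec k \<bullet> x) *\<^sub>R g x) $ j = of_int (k $ i) * (LINT x|torus. sin (ivec k \<bullet> x) *\<^sub>R f x) $ j"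
    and Sg: "(LINT x|torus. sin (ivec k \<bullet> x) *\<^sub>R g x) $ j = - (of_int (k $ i) * (LINT x|torus. cos (ivec k \<bullet> x) *\<^sub>R f x) $ j)"
    using arg_cong[OF e1, of "\<lambda>z. z $ j"] arg_cong[OF e2, of "\<lambda>z. z $ j"] by simp_all
  show ?thesis
    unfolding fourier_coeff_component[OF f] fourier_coeff_component[OF g] Cg Sg
    by (simp add: algebra_simps)
qed

section \<open>Sobolev spaces\<close>

lemma weight_ge_1: "1 \<le> 1 + (norm x)\<^sup>2" by simp

lemma sobolev_term_nonneg: "0 \<le> sobolev_term s f k"
  by (simp add: sobolev_term_def)

lemma sobolev_integrable: "f \<in> sobolev s \<Longrightarrow> integrable torus f"
  by (simp add: sobolev_def L2_torus_integrable)

lemma sobolev_mono: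
  assumes "s \<le> s'" shows "sobolev s' \<subseteq> sobolev s"
proof
  fix f :: "real^'n \<Rightarrow> real^'n" assume f: "f \<in> sobolev s'"
  have "sobolev_term s f k \<le> sobolev_term s' f k" for k
    unfolding sobolev_term_def using assms by (intro mult_right_mono powr_mono) auto
  then have "sobolev_term s f summable_on UNIV"
    using f by (auto intro!: summable_on_comparison_test[of "sobolev_term s' f" UNIV "sobolev_term s f"]
      simp: sobolev_def sobolev_term_nonneg)
  then show "f \<in> sobolev s" using f by (simp add: sobolev_def)
qed

lemma L2_torus_diff:
  assumes "f \<in> L2_torus" "g \<in> L2_torus"
  shows "(\<lambda>x. f x - g x) \<in> L2_torus"
proof -
  note [measurable] = assms[THEN L2_torus_measurable]
  have "integrable torus (\<lambda>x. (norm (f x - g x))\<^sup>2)"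
  proof (rule Bochner_Integration.integrable_bound)
    show "integrable torus (\<lambda>x. 2 * (norm (f x))\<^sup>2 + 2 * (norm (g x))\<^sup>2)"
      using assms by (auto simp: L2_torus_def)
    have "(norm (f x - g x))\<^sup>2 \<le> 2 * (norm (f x))\<^sup>2 + 2 * (norm (g x))\<^sup>2" for x
      using zero_le_power2[of "norm (f x + g x)"] unfolding power2_norm_eq_inner
      by (simp add: inner_diff inner_add inner_commute)
    then show "AE x in torus. norm ((norm (f x - g x))\<^sup>2) \<le> norm (2 * (norm (f x))\<^sup>2 + 2 * (norm (g x))\<^sup>2)"
      by simp
  qed measurable
  then show ?thesis by (simp add: L2_torus_def)
qed

lemma L2_torus_scaleR:
  assumes "f \<in> L2_torus"
  shows "(\<lambda>x. c *\<^sub>R f x) \<in> L2_torus"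
  using assms by (auto simp: L2_torus_def power_mult_distrib)

lemma sobolev_diff:
  assumes f: "f \<in> sobolev s" and g: "g \<in> sobolev s"
  shows "(\<lambda>x. f x - g x) \<in> sobolev s"
proof -
  have "sobolev_term s (\<lambda>x. f x - g x) k \<le> 2 * sobolev_term s f k + 2 * sobolev_term s g k" for k
  proof -
    have "(norm (fourier_coeff f k - fourier_coeff g k))\<^sup>2
        \<le> 2 * (norm (fourier_coeff f k))\<^sup>2 + 2 * (norm (fourier_coeff g k))\<^sup>2"
      using zero_le_power2[of "norm (fourier_coeff f k + fourier_coeff g k)"]
      unfolding power2_norm_eq_inner by (simp add: inner_diff inner_add inner_commute)
    then have "(1 + (norm (ivec k))\<^sup>2) powr s * (norm (fourier_coeff f k - fourier_coeff g k))\<^sup>2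
      \<le> (1 + (norm (ivec k))\<^sup>2) powr s * (2 * (norm (fourier_coeff f k))\<^sup>2 + 2 * (norm (fourier_coeff g k))\<^sup>2)"
      by (intro mult_left_mono) auto
    then show ?thesis
      unfolding sobolev_term_def fourier_coeff_diff[OF sobolev_integrable[OF f] sobolev_integrable[OF g]]
      by (simp add: algebra_simps)
  qed
  moreover have "(\<lambda>k. 2 * sobolev_term s f k + 2 * sobolev_term s g k) summable_on UNIV"
    using f g by (intro summable_on_add summable_on_cmult_right) (auto simp: sobolev_def)
  ultimately have "sobolev_term s (\<lambda>x. f x - g x) summable_on UNIV"
    using summable_on_comparison_test[of "\<lambda>k. 2 * sobolev_term s f k + 2 * sobolev_term s g k" UNIV
        "sobolev_term s (\<lambda>x. f x - g x)"] by (simp add: sobolev_term_nonneg)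
  then show ?thesis using f g by (simp add: sobolev_def L2_torus_diff)
qed

lemma sobolev_scaleR:
  assumes f: "f \<in> sobolev s"
  shows "(\<lambda>x. c *\<^sub>R f x) \<in> sobolev s"
proof -
  have "sobolev_term s (\<lambda>x. c *\<^sub>R f x) = (\<lambda>k. c\<^sup>2 * sobolev_term s f k)"
    by (auto simp: sobolev_term_def fourier_coeff_scaleR sobolev_integrable[OF f] power_mult_distrib)
  then show ?thesis
    using f by (simp add: sobolev_def L2_torus_scaleR summable_on_cmult_right)
qed

lemma sobolev_norm_power2: "(sobolev_norm s f)\<^sup>2 = (\<Sum>\<^sub>\<infinity>k. sobolev_term s f k)"
  by (simp add: sobolev_norm_def infsum_nonneg sobolev_term_nonneg)

text \<open>
  Convergence in a Sobolev norm implies convergence of each Fourier coefficient; this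
  transfers time derivatives of fields to time derivatives of coefficients.
\<close>

lemma norm_fourier_coeff_le:
  assumes "f \<in> sobolev s"
  shows "norm (fourier_coeff f k) \<le> (1 + (norm (ivec k))\<^sup>2) powr (- s / 2) * sobolev_norm s f"
proof (rule power2_le_imp_le)
  have "(\<Sum>\<^sub>\<infinity>k\<in>{k}. sobolev_term s f k) \<le> (\<Sum>\<^sub>\<infinity>k. sobolev_term s f k)"
    using assms by (intro infsum_mono_neutral) (auto simp: sobolev_def sobolev_term_nonneg)
  then have "sobolev_term s f k \<le> (sobolev_norm s f)\<^sup>2"
    by (simp add: sobolev_norm_power2)
  then have "(1 + (norm (ivec k))\<^sup>2) powr (- s) * sobolev_term s f k
     \<le> (1 + (norm (ivec k))\<^sup>2) powr (- s) * (sobolev_norm s f)\<^sup>2"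
    by (intro mult_left_mono) auto
  moreover have "(1 + (norm (ivec k))\<^sup>2) powr (- s) * (1 + (norm (ivec k))\<^sup>2) powr s = 1"
    by (simp add: add_pos_nonneg flip: powr_add) (metis weight_ge_1 not_one_le_zero)
  moreover have "((1 + (norm (ivec k))\<^sup>2) powr (- s / 2))\<^sup>2 = (1 + (norm (ivec k))\<^sup>2) powr (- s)"
    by (simp add: power2_eq_square flip: powr_add)
  ultimately show "(norm (fourier_coeff f k))\<^sup>2 \<le> ((1 + (norm (ivec k))\<^sup>2) powr (- s / 2) * sobolev_norm s f)\<^sup>2"
    by (simp add: sobolev_term_def power_mult_distrib flip: mult.assoc)
  show "0 \<le> (1 + (norm (ivec k))\<^sup>2) powr (- s / 2) * sobolev_norm s f"
    by (simp add: sobolev_norm_def infsum_nonneg sobolev_term_nonneg)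
qed

text \<open>
  Monotonicity of sums of nonnegative terms turns a bound for every frequency into a bound for
  the norms; the comparison with the convergent series of \<open>f\<close> and \<open>g\<close> also supplies the summability
  for \<open>u\<close>.
\<close>

lemma sobolev_norm_le_norm2:
  assumes f: "f \<in> sobolev s'" and g: "g \<in> sobolev s'" and "0 \<le> c"
    and le: "\<And>k. sobolev_term s u k \<le> c\<^sup>2 * (sobolev_term s' f k + sobolev_term s' g k)"
  shows "sobolev_norm s u \<le> c * sobolev_norm2 s' f g"
proof -
  have sum: "(\<lambda>k. sobolev_term s' f k + sobolev_term s' g k) summable_on UNIV"
    using f g by (intro summable_on_add) (auto simp: sobolev_def)
  have "(\<Sum>\<^sub>\<infinity>k. sobolev_term s u k) \<le> (\<Sum>\<^sub>\<infinity>k. c\<^sup>2 * (sobolev_term s' f k + sobolev_term s' g k))"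
  proof (rule infsum_mono)
    show "(\<lambda>k. c\<^sup>2 * (sobolev_term s' f k + sobolev_term s' g k)) summable_on UNIV"
      by (rule summable_on_cmult_right[OF sum])
    then show "sobolev_term s u summable_on UNIV"
      by (rule summable_on_comparison_test) (auto simp: le sobolev_term_nonneg)
  qed (rule le)
  also have "\<dots> = c\<^sup>2 * ((sobolev_norm s' f)\<^sup>2 + (sobolev_norm s' g)\<^sup>2)"
    using f g by (subst infsum_cmult_right[OF sum])
      (simp add: sobolev_norm_power2 infsum_add sobolev_def)
  finally show ?thesis
    unfolding sobolev_norm_def[of s u] sobolev_norm2_def
    by (metis real_sqrt_le_mono real_sqrt_mult real_sqrt_abs abs_of_nonneg \<open>0 \<le> c\<close>)
qed

section \<open>The system in Fourier variables\<close>

text \<open>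
  The remainder of the difference quotient of a coefficient is the coefficient of the remainder of
  the difference quotient of the field. The latter must be shown to lie in the Sobolev space, as the
  norm controls coefficients only there.
\<close>

lemma fourier_coeff_has_vector_derivative:
  assumes u: "\<And>t. t \<ge> 0 \<Longrightarrow> u t \<in> sobolev s" and u': "\<And>t. t \<ge> 0 \<Longrightarrow> u' t \<in> sobolev s"
    and der: "time_derivative s u u'" and "t \<ge> 0"
  shows "((\<lambda>t. fourier_coeff (u t) k) has_vector_derivative fourier_coeff (u' t) k) (at t within {0..})"
proof -
  define c where "c = (1 + (norm (ivec k))\<^sup>2) powr (- s / 2)"
  define q where "q \<tau> = (\<lambda>x. (u \<tau> x - u t x) /\<^sub>R (\<tau> - t) - u' t x)" for \<tau>
  have bound: "norm (fourier_coeff (u \<tau>) k - fourier_coeff (u t) k - (\<tau> - t) *\<^sub>R fourier_coeff (u' t) k) / norm (\<tau> - t)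
        \<le> c * sobolev_norm s (q \<tau>)" if "\<tau> \<ge> 0" "\<tau> \<noteq> t" for \<tau>
  proof -
    have d: "(\<lambda>x. u \<tau> x - u t x) \<in> sobolev s"
      using that \<open>t \<ge> 0\<close> u by (intro sobolev_diff) auto
    have qd: "(\<lambda>x. (u \<tau> x - u t x) /\<^sub>R (\<tau> - t)) \<in> sobolev s"
      using sobolev_scaleR[OF d] .
    have "q \<tau> \<in> sobolev s"
      unfolding q_def using qd u'[OF \<open>t \<ge> 0\<close>] by (rule sobolev_diff)
    then have "norm (fourier_coeff (q \<tau>) k) \<le> c * sobolev_norm s (q \<tau>)"
      unfolding c_def by (rule norm_fourier_coeff_le)
    moreover have "fourier_coeff (q \<tau>) k
      = (fourier_coeff (u \<tau>) k - fourier_coeff (u t) k) /\<^sub>R (\<tau> - t) - fourier_coeff (u' t) k"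
      unfolding q_def
      using sobolev_integrable[OF qd] sobolev_integrable[OF d] sobolev_integrable[OF u'[OF \<open>t \<ge> 0\<close>]]
        sobolev_integrable[OF u[OF \<open>t \<ge> 0\<close>]] sobolev_integrable[OF u[OF \<open>\<tau> \<ge> 0\<close>]]
      by (simp add: fourier_coeff_diff fourier_coeff_scaleR)
    moreover have "\<dots> = (fourier_coeff (u \<tau>) k - fourier_coeff (u t) k - (\<tau> - t) *\<^sub>R fourier_coeff (u' t) k) /\<^sub>R (\<tau> - t)"
      using that by (simp add: scaleR_diff_right)
    ultimately show ?thesis by (simp add: divide_inverse mult.commute)
  qed
  have "((\<lambda>\<tau>. c * sobolev_norm s (q \<tau>)) \<longlongrightarrow> c * 0) (at t within {0..})"
    using der \<open>t \<ge> 0\<close> by (intro tendsto_mult_left) (auto simp: time_derivative_def q_def)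
  then have lim: "((\<lambda>\<tau>. c * sobolev_norm s (q \<tau>)) \<longlongrightarrow> 0) (at t within {0..})" by simp
  have ev: "\<forall>\<^sub>F \<tau> in at t within {0..}. norm (fourier_coeff (u \<tau>) k - fourier_coeff (u t) k - (\<tau> - t) *\<^sub>R fourier_coeff (u' t) k) / norm (\<tau> - t) \<le> c * sobolev_norm s (q \<tau>)"
    unfolding eventually_at_filter using bound by (intro always_eventually) auto
  have "((\<lambda>\<tau>. norm (fourier_coeff (u \<tau>) k - fourier_coeff (u t) k - (\<tau> - t) *\<^sub>R fourier_coeff (u' t) k) / norm (\<tau> - t)) \<longlongrightarrow> 0)
      (at t within {0..})"
    by (rule tendsto_sandwich[OF _ ev tendsto_const lim]) (simp add: always_eventually)
  then show ?thesis
    by (simp add: has_vector_derivative_def has_derivative_iff_norm bounded_linear_scaleR_left)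
qed

lemma i_times_isometry: "norm (\<chi> j. \<i> * x $ j) = norm (x :: complex^'n)"
  by (simp add: norm_vec_def norm_mult)

lemma i_times_has_vector_derivative:
  fixes h :: "real \<Rightarrow> complex^'n"
  assumes "(h has_vector_derivative h') F"
  shows "((\<lambda>t. \<chi> j. \<i> * h t $ j) has_vector_derivative (\<chi> j. \<i> * h' $ j)) F"
proof -
  have "linear (\<lambda>x :: complex^'n. \<chi> j. \<i> * x $ j)"
    by (rule linearI) (simp_all add: vec_eq_iff algebra_simps)
  from bounded_linear.has_vector_derivative[OF linear_conv_bounded_linear[THEN iffD1, OF this] assms]
  show ?thesis .
qed

text \<open>
  The factor \<open>i\<close> in front of the coefficient of \<open>H\<close> absorbs the one that differentiation produces,
  which leaves a system with real coefficients in the real inner product space of complex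
  vectors.
\<close>

lemma solution_fourier_ode:
  fixes b :: "real^'n" and k :: "int^'n"
  assumes sol: "solution m b V0 H0 V H" and m: "m \<ge> 1" and t: "t \<ge> 0"
  defines "v \<equiv> \<lambda>t. fourier_coeff (V t) k"
    and "g \<equiv> \<lambda>t. \<chi> j. \<i> * fourier_coeff (H t) k $ j"
  shows "(v has_vector_derivative ((b \<bullet> ivec k) *\<^sub>R g t - v t)) (at t within {0..})"
    and "(g has_vector_derivative - ((b \<bullet> ivec k) *\<^sub>R v t)) (at t within {0..})"
proof -
  obtain Vt Ht DV DH where
    Vt: "continuous_in (real m - 1) Vt" "time_derivative (real m - 1) V Vt" and
    Ht: "continuous_in (real m - 1) Ht" "time_derivative (real m - 1) H Ht" and
    DV: "\<And>t i. t \<ge> 0 \<Longrightarrow> weak_partial i (V t) (DV t i)" and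
    DH: "\<And>t i. t \<ge> 0 \<Longrightarrow> weak_partial i (H t) (DH t i)" and
    eqV: "\<And>t. t \<ge> 0 \<Longrightarrow> AE x in torus. Vt t x + V t x = (\<Sum>i\<in>UNIV. b $ i *\<^sub>R DH t i x)" and
    eqH: "\<And>t. t \<ge> 0 \<Longrightarrow> AE x in torus. Ht t x = (\<Sum>i\<in>UNIV. b $ i *\<^sub>R DV t i x)"
    using sol unfolding solution_def by blast
  have V: "V s \<in> sobolev (real m - 1)" and H: "H s \<in> sobolev (real m - 1)"
    and Vt_mem: "Vt s \<in> sobolev (real m - 1)" and Ht_mem: "Ht s \<in> sobolev (real m - 1)" if "s \<ge> 0" for s
    using sol that Vt(1) Ht(1) sobolev_mono[of "real m - 1" "real m"]
    by (auto simp: solution_def continuous_in_def)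
  \<comment> \<open>the Fourier symbol of \<open>b \<bullet> \<nabla>\<close> is multiplication by \<open>i (b \<bullet> k)\<close>\<close>
  have transport: "fourier_coeff (\<lambda>x. \<Sum>i\<in>UNIV. b $ i *\<^sub>R D i x) k = (\<chi> j. \<i> * of_real (b \<bullet> ivec k) * fourier_coeff f k $ j)"
    if "\<And>i. weak_partial i f (D i)" for f D
  proof -
    have D: "integrable torus (D i)" for i
      using that[of i] by (auto simp: weak_partial_def L2_torus_integrable)
    have "fourier_coeff (\<lambda>x. \<Sum>i\<in>UNIV. b $ i *\<^sub>R D i x) k $ j = \<i> * of_real (b \<bullet> ivec k) * fourier_coeff f k $ j" for j
    proof -
      have "fourier_coeff (\<lambda>x. \<Sum>i\<in>UNIV. b $ i *\<^sub>R D i x) k = (\<Sum>i\<in>UNIV. b $ i *\<^sub>R fourier_coeff (D i) k)"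
        using D by (subst fourier_coeff_sum) (auto simp: fourier_coeff_scaleR)
      then show ?thesis
        using fourier_coeff_weak_partial[OF that, where k = k and j = j]
        by (simp add: inner_vec_def ivec_def sum_distrib_left sum_distrib_right
            scaleR_conv_of_real[where 'a = complex] mult_ac)
    qed
    then show ?thesis by (simp add: vec_eq_iff)
  qed
  have meas_sum: "(\<lambda>x. \<Sum>i\<in>UNIV. b $ i *\<^sub>R D i x) \<in> borel_measurable torus"
    if "\<And>i. weak_partial i f (D i)" for f D
    using that by (intro borel_measurable_sum borel_measurable_scaleR borel_measurable_const L2_torus_measurable)
      (auto simp: weak_partial_def)
  have mV: "V t \<in> borel_measurable torus" "Vt t \<in> borel_measurable torus" "Ht t \<in> borel_measurable torus"
    using V[OF t] Vt_mem[OF t] Ht_mem[OF t] by (auto simp: sobolev_def L2_torus_measurable)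
  have "fourier_coeff (Vt t) k + v t = fourier_coeff (\<lambda>x. Vt t x + V t x) k"
    unfolding v_def using V[OF t] Vt_mem[OF t] by (simp add: fourier_coeff_add sobolev_integrable)
  also have "\<dots> = fourier_coeff (\<lambda>x. \<Sum>i\<in>UNIV. b $ i *\<^sub>R DH t i x) k"
    using mV by (intro fourier_coeff_cong_AE eqV[OF t] meas_sum[OF DH[OF t]]) measurable
  also have "\<dots> = (b \<bullet> ivec k) *\<^sub>R g t"
    unfolding transport[OF DH[OF t]] g_def vec_eq_iff by (simp add: scaleR_conv_of_real[where 'a = complex])
  finally have "fourier_coeff (Vt t) k = (b \<bullet> ivec k) *\<^sub>R g t - v t" by (simp add: algebra_simps)
  then show "(v has_vector_derivative ((b \<bullet> ivec k) *\<^sub>R g t - v t)) (at t within {0..})"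
    using fourier_coeff_has_vector_derivative[OF V Vt_mem Vt(2) t, of k] by (simp add: v_def)
  have "fourier_coeff (Ht t) k = fourier_coeff (\<lambda>x. \<Sum>i\<in>UNIV. b $ i *\<^sub>R DV t i x) k"
    using mV by (intro fourier_coeff_cong_AE eqH[OF t] meas_sum[OF DV[OF t]])
  also have "\<dots> = (\<chi> j. \<i> * of_real (b \<bullet> ivec k) * v t $ j)"
    unfolding transport[OF DV[OF t]] v_def ..
  finally have "(\<chi> j. \<i> * fourier_coeff (Ht t) k $ j) = - ((b \<bullet> ivec k) *\<^sub>R v t)"
    by (simp add: vec_eq_iff scaleR_conv_of_real[where 'a = complex] flip: mult.assoc)
  then show "(g has_vector_derivative - ((b \<bullet> ivec k) *\<^sub>R v t)) (at t within {0..})"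
    using i_times_has_vector_derivative[OF fourier_coeff_has_vector_derivative[OF H Ht_mem Ht(2) t, of k]]
    by (simp add: g_def)
qed

section \<open>Decay rates from the Diophantine condition\<close>

lemma norm_ivec_ge_1:
  assumes "k \<noteq> 0" shows "1 \<le> norm (ivec k)"
proof -
  obtain i where "k $ i \<noteq> 0" using assms by (auto simp: vec_eq_iff)
  then have "1 \<le> \<bar>ivec k $ i\<bar>" by (simp add: ivec_def flip: of_int_abs)
  also have "\<dots> \<le> norm (ivec k)" by (rule component_le_norm_cart)
  finally show ?thesis .
qed

text \<open>
  The map \<open>x \<mapsto> x / (1 + x)\<close> is increasing, so the lower bound on \<open>|b \<bullet> k|\<close> passes to the rate; the
  saturation at large \<open>\<omega>\<close> costs only the constant factor \<open>1 / (1 + c\<^sup>2)\<close>.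
\<close>

lemma damping_rate_diophantine:
  fixes b :: "real^'n"
  assumes "diophantine r b" "r > 0"
  shows "\<exists>a>0. \<forall>k. k \<noteq> 0 \<longrightarrow> a * (1 + (norm (ivec k))\<^sup>2) powr (- r) \<le> damping_rate (b \<bullet> ivec k)"
proof -
  obtain c where c: "c > 0" "\<And>k :: int^'n. k \<noteq> 0 \<Longrightarrow> c * norm (ivec k) powr (- r) \<le> \<bar>b \<bullet> ivec k\<bar>"
    using assms by (auto simp: diophantine_def)
  define a where "a = 2 / 5 * (c\<^sup>2 / (1 + c\<^sup>2))"
  have pos: "0 < 1 + x\<^sup>2" for x :: real by (simp add: add_pos_nonneg)
  have mono: "x / (1 + x) \<le> y / (1 + y)" if "0 \<le> x" "x \<le> y" for x y :: real
    using that by (simp add: field_simps)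
  have "a * (1 + (norm (ivec k))\<^sup>2) powr (- r) \<le> damping_rate (b \<bullet> ivec k)" if k: "k \<noteq> 0" for k :: "int^'n"
  proof -
    define Y where "Y = (1 + (norm (ivec k))\<^sup>2) powr (- r)"
    have "Y \<le> (norm (ivec k) ^ 2) powr (- r)"
      unfolding Y_def using norm_ivec_ge_1[OF k] assms by (intro powr_mono2') auto
    also have "\<dots> = (norm (ivec k) powr (- r))\<^sup>2"
      by (simp add: power2_eq_square powr_mult)
    finally have Y: "Y \<le> (norm (ivec k) powr (- r))\<^sup>2" .
    have "Y \<le> 1"
      unfolding Y_def using assms powr_mono[of "- r" 0 "1 + (norm (ivec k))\<^sup>2"]
      by (simp split: if_splits)
    have "0 \<le> Y" by (simp add: Y_def)
    have "c\<^sup>2 * Y \<le> (c * norm (ivec k) powr (- r))\<^sup>2"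
      using Y by (simp add: power_mult_distrib mult_left_mono)
    also have "\<dots> \<le> \<bar>b \<bullet> ivec k\<bar>\<^sup>2"
      using c k by (intro power_mono) auto
    finally have "c\<^sup>2 * Y \<le> (b \<bullet> ivec k)\<^sup>2" by simp
    then have "c\<^sup>2 * Y / (1 + c\<^sup>2 * Y) \<le> (b \<bullet> ivec k)\<^sup>2 / (1 + (b \<bullet> ivec k)\<^sup>2)"
      using \<open>0 \<le> Y\<close> by (intro mono) auto
    moreover have "c\<^sup>2 / (1 + c\<^sup>2) * Y \<le> c\<^sup>2 * Y / (1 + c\<^sup>2 * Y)"
    proof -
      have "c\<^sup>2 * Y \<le> c\<^sup>2" using \<open>Y \<le> 1\<close> by (simp add: mult_left_le)
      then have "c\<^sup>2 * Y / (1 + c\<^sup>2) \<le> c\<^sup>2 * Y / (1 + c\<^sup>2 * Y)"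
        using \<open>0 \<le> Y\<close> pos[of c] by (intro divide_left_mono mult_pos_pos) (auto intro: add_pos_nonneg)
      then show ?thesis by simp
    qed
    ultimately have "c\<^sup>2 / (1 + c\<^sup>2) * Y \<le> (b \<bullet> ivec k)\<^sup>2 / (1 + (b \<bullet> ivec k)\<^sup>2)"
      by (rule order_trans[rotated])
    then have "2 / 5 * (c\<^sup>2 / (1 + c\<^sup>2) * Y) \<le> 2 / 5 * ((b \<bullet> ivec k)\<^sup>2 / (1 + (b \<bullet> ivec k)\<^sup>2))"
      by (intro mult_left_mono) auto
    then show ?thesis unfolding a_def damping_rate_def Y_def[symmetric] mult.assoc .
  qed
  moreover have "a > 0" using \<open>c > 0\<close> pos[of c] by (simp add: a_def)
  ultimately show ?thesis by blast
qed

section \<open>Decay of solutions\<close>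

text \<open>
  The two decay estimates for a single frequency, combined with the loss of \<open>m - s\<close> derivatives.
  The order of the quantifiers matters: \<open>K\<close> must not depend on \<open>k\<close>, so that the bounds can be summed.
\<close>

lemma sobolev_term_decay:
  fixes b :: "real^'n"
  assumes dio: "diophantine r b" and r: "r > 0" and m: "m \<ge> 1"
  shows "\<exists>K\<ge>1. \<forall>V0 H0 V H t s k.
      V0 \<in> sobolev (real m) \<longrightarrow> H0 \<in> sobolev (real m) \<longrightarrow>
      (LINT x|torus. V0 x) = 0 \<longrightarrow> (LINT x|torus. H0 x) = 0 \<longrightarrow>
      solution m b V0 H0 V H \<longrightarrow> t \<ge> 0 \<longrightarrow> 0 \<le> s \<longrightarrow> s \<le> real m \<longrightarrow>
      (1 + t) * sobolev_term s (V t) k \<le> K * (1 + t) powr (- ((real m - s) / r))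
         * (sobolev_term (real m) V0 k + sobolev_term (real m) H0 k) \<and>
      sobolev_term s (V t) k + sobolev_term s (H t) k \<le> K * (1 + t) powr (- ((real m - s) / r))
         * (sobolev_term (real m) V0 k + sobolev_term (real m) H0 k)"
proof -
  obtain a where a: "a > 0"
    "\<And>k. k \<noteq> 0 \<Longrightarrow> a * (1 + (norm (ivec k))\<^sup>2) powr (- r) \<le> damping_rate (b \<bullet> ivec k)"
    using damping_rate_diophantine[OF dio r] by blast
  obtain K where K: "K \<ge> 1" "\<And>X t \<sigma>. X \<ge> 1 \<Longrightarrow> t \<ge> 0 \<Longrightarrow> 0 \<le> \<sigma> \<Longrightarrow> \<sigma> \<le> real m \<Longrightarrow>
     exp (- (a / 2 * t * X powr (- r))) * X powr (- \<sigma>) \<le> K * (1 + t) powr (- (\<sigma> / r))"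
    using derivative_loss_decay[of "a / 2" r "real m"] a(1) r by auto
  show ?thesis
  proof (intro exI[of _ "30 * K"] conjI allI impI)
    show "1 \<le> 30 * K" using K by simp
  next
    fix V0 H0 :: "real^'n \<Rightarrow> real^'n" and V H and t s :: real and k :: "int^'n"
    assume V0: "V0 \<in> sobolev (real m)" "(LINT x|torus. V0 x) = 0"
      and H0: "H0 \<in> sobolev (real m)" "(LINT x|torus. H0 x) = 0"
      and sol: "solution m b V0 H0 V H" and t: "t \<ge> 0" and s: "0 \<le> s" "s \<le> real m"
    define X where "X = 1 + (norm (ivec k))\<^sup>2"
    have X: "X \<ge> 1" by (simp add: X_def)
    define v where "v = (\<lambda>t. fourier_coeff (V t) k)"
    define g where "g = (\<lambda>t. \<chi> j. \<i> * fourier_coeff (H t) k $ j)"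
    define \<mu> where "\<mu> = damping_rate (b \<bullet> ivec k)"
    define E0 where "E0 = (norm (v 0))\<^sup>2 + (norm (g 0))\<^sup>2"
    define P where "P = (1 + t) powr (- ((real m - s) / r))"
    define T where "T = sobolev_term (real m) V0 k + sobolev_term (real m) H0 k"
    have [simp]: "0 \<le> E0" by (simp add: E0_def)
    have norm_g: "norm (g \<tau>) = norm (fourier_coeff (H \<tau>) k)" for \<tau>
      unfolding g_def by (rule i_times_isometry)
    have ode: "(v has_vector_derivative ((b \<bullet> ivec k) *\<^sub>R g \<tau> - v \<tau>)) (at \<tau> within {0..})"
      "(g has_vector_derivative - ((b \<bullet> ivec k) *\<^sub>R v \<tau>)) (at \<tau> within {0..})" if "\<tau> \<ge> 0" for \<tau>
      unfolding v_def g_def using solution_fourier_ode[OF sol m that] by auto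
    have init: "fourier_coeff (V 0) k = fourier_coeff V0 k" "fourier_coeff (H 0) k = fourier_coeff H0 k"
      using sol V0(1) H0(1)
      by (auto intro!: fourier_coeff_cong_AE simp: solution_def continuous_in_def sobolev_def L2_torus_measurable)
    have T: "T = X powr real m * E0"
      by (simp add: T_def E0_def norm_g v_def init sobolev_term_def X_def algebra_simps)
    \<comment> \<open>at \<open>k = 0\<close> both sides vanish since the data are mean free\<close>
    have gain: "X powr s * (exp (- (\<mu> * t / 2)) * E0) \<le> K * P * T"
    proof (cases "k = 0")
      case True
      have "fourier_coeff V0 0 = 0" "fourier_coeff H0 0 = 0"
        using V0 H0 by (auto intro!: fourier_coeff_zero_of_mean_zero intro: sobolev_integrable)
      then have "E0 = 0"
        using True init by (simp add: E0_def norm_g v_def)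
      then show ?thesis by (simp add: T)
    next
      case False
      have "a * X powr (- r) * t \<le> \<mu> * t"
        unfolding X_def \<mu>_def using a(2)[OF False] t by (rule mult_right_mono)
      then have "exp (- (\<mu> * t / 2)) \<le> exp (- (a / 2 * t * X powr (- r)))"
        by (simp add: mult_ac)
      then have "exp (- (\<mu> * t / 2)) * X powr (- (real m - s)) \<le> exp (- (a / 2 * t * X powr (- r))) * X powr (- (real m - s))"
        by (intro mult_right_mono) auto
      also have "\<dots> \<le> K * P"
        unfolding P_def using X t s by (intro K(2)) auto
      finally have "(exp (- (\<mu> * t / 2)) * X powr (- (real m - s))) * T \<le> K * P * T"
        by (intro mult_right_mono) (auto simp: T)
      moreover have "X powr (- (real m - s)) * T = X powr s * E0"
        unfolding T using X by (simp flip: powr_add mult.assoc)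
      ultimately show ?thesis by (metis mult.assoc mult.left_commute)
    qed
    have "(1 + t) * (norm (v t))\<^sup>2 \<le> 30 * exp (- (\<mu> * t / 2)) * E0"
      unfolding \<mu>_def E0_def by (rule damped_component_decay[OF ode t])
    then have "X powr s * ((1 + t) * (norm (v t))\<^sup>2) \<le> X powr s * (30 * exp (- (\<mu> * t / 2)) * E0)"
      by (intro mult_left_mono) auto
    also have "\<dots> \<le> 30 * K * P * T" using gain by simp
    finally show "(1 + t) * sobolev_term s (V t) k \<le> 30 * K * (1 + t) powr (- ((real m - s) / r))
         * (sobolev_term (real m) V0 k + sobolev_term (real m) H0 k)"
      by (simp add: sobolev_term_def X_def v_def P_def T_def mult_ac)
    have "(norm (v t))\<^sup>2 + (norm (g t))\<^sup>2 \<le> 5 / 3 * exp (- (\<mu> * t)) * E0"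
      unfolding \<mu>_def E0_def by (rule energy_decay[OF ode t])
    also have "\<dots> \<le> 30 * exp (- (\<mu> * t / 2)) * E0"
      using t damping_rate_nonneg[of "b \<bullet> ivec k"]
      by (intro mult_right_mono mult_mono) (auto simp: \<mu>_def)
    finally have "X powr s * ((norm (v t))\<^sup>2 + (norm (g t))\<^sup>2) \<le> X powr s * (30 * exp (- (\<mu> * t / 2)) * E0)"
      by (intro mult_left_mono) auto
    also have "\<dots> \<le> 30 * K * P * T" using gain by simp
    finally show "sobolev_term s (V t) k + sobolev_term s (H t) k \<le> 30 * K * (1 + t) powr (- ((real m - s) / r))
         * (sobolev_term (real m) V0 k + sobolev_term (real m) H0 k)"
      by (simp add: sobolev_term_def X_def v_def norm_g P_def T_def distrib_left mult_ac)
  qed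
qed

theorem theorem1p1:
  fixes b :: "real^'n" and r :: real and m :: nat
  assumes "CARD('n) \<ge> 2" and "r > real CARD('n) - 1"
    and "diophantine r b"
    and "m \<ge> 1"
  shows "\<exists>C>0. \<forall>V0 H0 V H.
      V0 \<in> sobolev (real m) \<longrightarrow> H0 \<in> sobolev (real m) \<longrightarrow>
      (LINT x|torus. V0 x) = 0 \<longrightarrow> (LINT x|torus. H0 x) = 0 \<longrightarrow>
      solution m b V0 H0 V H \<longrightarrow>
      (\<forall>t\<ge>0.
        (\<forall>s. 0 \<le> s \<and> s \<le> real m - 1 \<longrightarrow>
          sobolev_norm s (V t)
            \<le> C * (1 + t) powr (- 1 / 2 - (real m - s) / (2 * r)) * sobolev_norm2 (real m) V0 H0) \<and>
        sobolev_norm (real m) (V t) \<le> C * sobolev_norm2 (real m) V0 H0 \<and>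
        (\<forall>s. 0 \<le> s \<and> s \<le> real m \<longrightarrow>
          sobolev_norm s (H t)
            \<le> C * (1 + t) powr (- ((real m - s) / (2 * r))) * sobolev_norm2 (real m) V0 H0))"
proof -
  have r: "r > 0" using assms by linarith
  obtain K where K: "K \<ge> 1" and decay: "\<And>V0 H0 V H t s k.
      V0 \<in> sobolev (real m) \<Longrightarrow> H0 \<in> sobolev (real m) \<Longrightarrow>
      (LINT x|torus. V0 x) = 0 \<Longrightarrow> (LINT x|torus. H0 x) = 0 \<Longrightarrow>
      solution m b V0 H0 V H \<Longrightarrow> t \<ge> 0 \<Longrightarrow> 0 \<le> s \<Longrightarrow> s \<le> real m \<Longrightarrow>
      (1 + t) * sobolev_term s (V t) k \<le> K * (1 + t) powr (- ((real m - s) / r))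
         * (sobolev_term (real m) V0 k + sobolev_term (real m) H0 k) \<and>
      sobolev_term s (V t) k + sobolev_term s (H t) k \<le> K * (1 + t) powr (- ((real m - s) / r))
         * (sobolev_term (real m) V0 k + sobolev_term (real m) H0 k)"
    using sobolev_term_decay[OF \<open>diophantine r b\<close> r \<open>m \<ge> 1\<close>] by blast
  define C where "C = sqrt K"
  have C: "C > 0" "C\<^sup>2 = K" using K by (auto simp: C_def)
  have sq: "(C * (1 + t) powr p)\<^sup>2 = K * (1 + t) powr (2 * p)" for t p :: real
    by (simp add: power_mult_distrib C power2_eq_square[of "_ powr _"] flip: powr_add)
  show ?thesis
  proof (intro exI[of _ C] conjI allI impI)
    fix V0 H0 :: "real^'n \<Rightarrow> real^'n" and V H and t :: real
    assume V0: "V0 \<in> sobolev (real m)" and H0: "H0 \<in> sobolev (real m)"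
      and means: "(LINT x|torus. V0 x) = 0" "(LINT x|torus. H0 x) = 0"
      and sol: "solution m b V0 H0 V H" and t: "0 \<le> t"
    note decay = decay[OF V0 H0 means sol t]
    have VH: "sobolev_norm s (V t) \<le> C * (1 + t) powr (- ((real m - s) / (2 * r))) * sobolev_norm2 (real m) V0 H0"
        "sobolev_norm s (H t) \<le> C * (1 + t) powr (- ((real m - s) / (2 * r))) * sobolev_norm2 (real m) V0 H0"
      if "0 \<le> s" "s \<le> real m" for s
    proof -
      have e: "(C * (1 + t) powr (- ((real m - s) / (2 * r))))\<^sup>2 = K * (1 + t) powr (- ((real m - s) / r))"
      proof -
        have "2 * (- ((real m - s) / (2 * r))) = - ((real m - s) / r)" using r by (simp add: field_simps)
        then show ?thesis unfolding sq by (rule arg_cong)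
      qed
      show "sobolev_norm s (V t) \<le> C * (1 + t) powr (- ((real m - s) / (2 * r))) * sobolev_norm2 (real m) V0 H0"
      proof (rule sobolev_norm_le_norm2[OF V0 H0])
        show "sobolev_term s (V t) k \<le> (C * (1 + t) powr (- ((real m - s) / (2 * r))))\<^sup>2
            * (sobolev_term (real m) V0 k + sobolev_term (real m) H0 k)" for k
          unfolding e using decay[OF that, of k] sobolev_term_nonneg[of s "H t" k] by linarith
      qed (use C in auto)
      show "sobolev_norm s (H t) \<le> C * (1 + t) powr (- ((real m - s) / (2 * r))) * sobolev_norm2 (real m) V0 H0"
      proof (rule sobolev_norm_le_norm2[OF V0 H0])
        show "sobolev_term s (H t) k \<le> (C * (1 + t) powr (- ((real m - s) / (2 * r))))\<^sup>2
            * (sobolev_term (real m) V0 k + sobolev_term (real m) H0 k)" for k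
          unfolding e using decay[OF that, of k] sobolev_term_nonneg[of s "V t" k] by linarith
      qed (use C in auto)
    qed
    show "sobolev_norm s (H t) \<le> C * (1 + t) powr (- ((real m - s) / (2 * r))) * sobolev_norm2 (real m) V0 H0"
      if "0 \<le> s \<and> s \<le> real m" for s
      using VH(2) that by blast
    show "sobolev_norm (real m) (V t) \<le> C * sobolev_norm2 (real m) V0 H0"
      using VH(1)[of "real m"] t by simp
    show "sobolev_norm s (V t) \<le> C * (1 + t) powr (- 1 / 2 - (real m - s) / (2 * r)) * sobolev_norm2 (real m) V0 H0"
      if "0 \<le> s \<and> s \<le> real m - 1" for s
    proof (rule sobolev_norm_le_norm2[OF V0 H0])
      fix k
      have "2 * (- 1 / 2 - (real m - s) / (2 * r)) = - ((real m - s) / r) - 1"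
        using r by (simp add: field_simps)
      then have e: "(C * (1 + t) powr (- 1 / 2 - (real m - s) / (2 * r)))\<^sup>2 = K * (1 + t) powr (- ((real m - s) / r)) / (1 + t)"
        using t unfolding sq by (simp only: powr_diff) simp
      have "(1 + t) * sobolev_term s (V t) k \<le> K * (1 + t) powr (- ((real m - s) / r))
          * (sobolev_term (real m) V0 k + sobolev_term (real m) H0 k)"
        using decay[of s k] that by auto
      then have "sobolev_term s (V t) k \<le> K * (1 + t) powr (- ((real m - s) / r))
          * (sobolev_term (real m) V0 k + sobolev_term (real m) H0 k) / (1 + t)"
        using t by (simp add: pos_le_divide_eq mult.commute)
      then show "sobolev_term s (V t) k \<le> (C * (1 + t) powr (- 1 / 2 - (real m - s) / (2 * r)))\<^sup>2
          * (sobolev_term (real m) V0 k + sobolev_term (real m) H0 k)"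
        unfolding e by simp
    qed (use C in auto)
  qed (use C in auto)
qed

end
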